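(* Let $D\neq\{1\}$ and $Q$ be groups, let $\Omega$ be a $Q$-set, and let $G=D\wr_{\Omega r}Q$ be the restricted wreath product; assume $G\neq\{1\}$. Then $G$ is icc if and only if both of the following hold: (1) at least one of the following conditions holds: (i.a) $D$ is icc; (i.b) all $Q$-orbits in $\Omega$ are infinite; (2) the following condition holds: (ii) $1$ is the only element of $FC(Q)$ which fixes $\Omega$ pointwise.
   Context: A group is icc if it is infinite and all of its conjugacy classes except $\{1\}$ are infinite. A $Q$-set is a set with a left $Q$-action. The restricted wreath product $D\wr_{\Omega r}Q$ is the semi-direct product $D^{(\Omega)}\rtimes Q$, where $D^{(\Omega)}$ is the group (under pointwise multiplication) of maps $\phi:\Omega\to D$ with finite support, and $q\in Q$ acts by $(q\phi q^{-1})(x)=\phi(q^{-1}x)$. $FC(Q)$ is the subgroup of elements of $Q$ with finite conjugacy class. *)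

theory Defs
  imports "HOL-Algebra.Group_Action" "HOL-Algebra.Product_Groups"
begin

definition conj_class :: "('a, 'm) monoid_scheme \<Rightarrow> 'a \<Rightarrow> 'a set" where
  "conj_class G g = {h \<otimes>\<^bsub>G\<^esub> g \<otimes>\<^bsub>G\<^esub> inv\<^bsub>G\<^esub> h | h. h \<in> carrier G}"

definition icc :: "('a, 'm) monoid_scheme \<Rightarrow> bool" where
  "icc G \<longleftrightarrow> infinite (carrier G) \<and> (\<forall>g \<in> carrier G. g \<noteq> \<one>\<^bsub>G\<^esub> \<longrightarrow> infinite (conj_class G g))"

definition FC :: "('a, 'm) monoid_scheme \<Rightarrow> 'a set" where
  "FC G = {g \<in> carrier G. finite (conj_class G g)}"

definition semidirect_product ::
    "('n, 'm) monoid_scheme \<Rightarrow> ('q, 'k) monoid_scheme \<Rightarrow> ('q \<Rightarrow> 'n \<Rightarrow> 'n) \<Rightarrow> ('n \<times> 'q) monoid" where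
  "semidirect_product N Q \<theta> =
     \<lparr>carrier = carrier N \<times> carrier Q,
      mult = (\<lambda>(n, q) (n', q'). (n \<otimes>\<^bsub>N\<^esub> \<theta> q n', q \<otimes>\<^bsub>Q\<^esub> q')),
      one = (\<one>\<^bsub>N\<^esub>, \<one>\<^bsub>Q\<^esub>)\<rparr>"

text \<open>Elements of a \<open>sum_group\<close> over \<open>\<Omega>\<close> are extensional functions, i.e. \<open>undefined\<close> outside
  \<open>\<Omega>\<close>; hence the restriction to \<open>\<Omega>\<close>.\<close>

definition translate ::
    "('q, 'k) monoid_scheme \<Rightarrow> 'x set \<Rightarrow> ('q \<Rightarrow> 'x \<Rightarrow> 'x) \<Rightarrow> 'q \<Rightarrow> ('x \<Rightarrow> 'd) \<Rightarrow> ('x \<Rightarrow> 'd)" where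
  "translate Q \<Omega> \<alpha> q f = (\<lambda>x\<in>\<Omega>. f (\<alpha> (inv\<^bsub>Q\<^esub> q) x))"

definition restricted_wreath ::
    "('d, 'm) monoid_scheme \<Rightarrow> ('q, 'k) monoid_scheme \<Rightarrow> 'x set \<Rightarrow> ('q \<Rightarrow> 'x \<Rightarrow> 'x)
      \<Rightarrow> (('x \<Rightarrow> 'd) \<times> 'q) monoid" where
  "restricted_wreath D Q \<Omega> \<alpha> = semidirect_product (sum_group \<Omega> (\<lambda>_. D)) Q (translate Q \<Omega> \<alpha>)"

lemma carrier_restricted_wreath:
  assumes "group D"
  shows "carrier (restricted_wreath D Q \<Omega> \<alpha>) =
    {f \<in> \<Omega> \<rightarrow>\<^sub>E carrier D. finite {x \<in> \<Omega>. f x \<noteq> \<one>\<^bsub>D\<^esub>}} \<times> carrier Q"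
  using assms by (simp add: restricted_wreath_def semidirect_product_def carrier_sum_group)

lemma mult_restricted_wreath:
  "(f, q) \<otimes>\<^bsub>restricted_wreath D Q \<Omega> \<alpha>\<^esub> (f', q') =
     (\<lambda>x\<in>\<Omega>. f x \<otimes>\<^bsub>D\<^esub> f' (\<alpha> (inv\<^bsub>Q\<^esub> q) x), q \<otimes>\<^bsub>Q\<^esub> q')"
  by (auto simp: restricted_wreath_def semidirect_product_def translate_def)

lemma one_restricted_wreath:
  "\<one>\<^bsub>restricted_wreath D Q \<Omega> \<alpha>\<^esub> = (\<lambda>x\<in>\<Omega>. \<one>\<^bsub>D\<^esub>, \<one>\<^bsub>Q\<^esub>)"
  by (simp add: restricted_wreath_def semidirect_product_def)

lemma group_restricted_wreath:
  assumes D: "group D" and A: "group_action Q \<Omega> \<alpha>"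
  shows "group (restricted_wreath D Q \<Omega> \<alpha>)" (is "group ?G")
proof -
  interpret D: group D by fact
  interpret A: group_action Q \<Omega> \<alpha> by fact
  interpret Q: group Q using A.group_hom by (simp add: group_hom_def)
  note cl = A.element_image[OF _ _ refl]
  have comp: "\<alpha> (a \<otimes>\<^bsub>Q\<^esub> b) x = \<alpha> a (\<alpha> b x)"
    if "a \<in> carrier Q" "b \<in> carrier Q" "x \<in> \<Omega>" for a b x
    using that by (simp add: A.composition_rule)
  have one: "\<alpha> \<one>\<^bsub>Q\<^esub> x = x" if "x \<in> \<Omega>" for x
    using that A.id_eq_one by (metis restrict_apply')
  have fin: "finite {x \<in> \<Omega>. f (\<alpha> q x) \<noteq> \<one>\<^bsub>D\<^esub>}"
    if q: "q \<in> carrier Q" and f: "finite {x \<in> \<Omega>. f x \<noteq> \<one>\<^bsub>D\<^esub>}" for q and f :: "_ \<Rightarrow> _"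
  proof (rule finite_imageD[of "\<alpha> q"])
    show "finite (\<alpha> q ` {x \<in> \<Omega>. f (\<alpha> q x) \<noteq> \<one>\<^bsub>D\<^esub>})"
      by (rule finite_subset[OF _ f]) (use q cl in auto)
    show "inj_on (\<alpha> q) {x \<in> \<Omega>. f (\<alpha> q x) \<noteq> \<one>\<^bsub>D\<^esub>}"
      using A.inj_prop[OF q] by (rule inj_on_subset) auto
  qed
  note C = carrier_restricted_wreath[OF D] 
  show ?thesis
  proof (rule groupI)
    fix u v assume "u \<in> carrier ?G" "v \<in> carrier ?G"
    then obtain f q f' q' where uv: "u = (f, q)" "v = (f', q')"
      and f: "f \<in> \<Omega> \<rightarrow>\<^sub>E carrier D" "finite {x \<in> \<Omega>. f x \<noteq> \<one>\<^bsub>D\<^esub>}" "q \<in> carrier Q"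
      and f': "f' \<in> \<Omega> \<rightarrow>\<^sub>E carrier D" "finite {x \<in> \<Omega>. f' x \<noteq> \<one>\<^bsub>D\<^esub>}" "q' \<in> carrier Q"
      by (auto simp: C)
    have "finite {x \<in> \<Omega>. f x \<otimes>\<^bsub>D\<^esub> f' (\<alpha> (inv\<^bsub>Q\<^esub> q) x) \<noteq> \<one>\<^bsub>D\<^esub>}"
      by (rule finite_subset[OF _ finite_UnI[OF f(2) fin[OF Q.inv_closed[OF f(3)] f'(2)]]])
        (use D.l_one[OF D.one_closed] in auto)
    then show "u \<otimes>\<^bsub>?G\<^esub> v \<in> carrier ?G"
      using f f' cl unfolding uv mult_restricted_wreath C
      by (auto simp: PiE_iff cong: conj_cong)
  next
    show "\<one>\<^bsub>?G\<^esub> \<in> carrier ?G"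
      unfolding one_restricted_wreath C by (auto cong: conj_cong)
  next
    fix u v w assume "u \<in> carrier ?G" "v \<in> carrier ?G" "w \<in> carrier ?G"
    then obtain f q f' q' f'' q'' where uvw: "u = (f, q)" "v = (f', q')" "w = (f'', q'')"
      and h: "f \<in> \<Omega> \<rightarrow>\<^sub>E carrier D" "q \<in> carrier Q" "f' \<in> \<Omega> \<rightarrow>\<^sub>E carrier D" "q' \<in> carrier Q"
        "f'' \<in> \<Omega> \<rightarrow>\<^sub>E carrier D" "q'' \<in> carrier Q"
      by (auto simp: C)
    have "f'' (\<alpha> (inv\<^bsub>Q\<^esub> (q \<otimes>\<^bsub>Q\<^esub> q')) x) = f'' (\<alpha> (inv\<^bsub>Q\<^esub> q') (\<alpha> (inv\<^bsub>Q\<^esub> q) x))"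
      if "x \<in> \<Omega>" for x
      using h that by (simp add: Q.inv_mult_group comp)
    then show "u \<otimes>\<^bsub>?G\<^esub> v \<otimes>\<^bsub>?G\<^esub> w = u \<otimes>\<^bsub>?G\<^esub> (v \<otimes>\<^bsub>?G\<^esub> w)"
      using h cl unfolding uvw mult_restricted_wreath
      by (auto simp: PiE_iff D.m_assoc Q.m_assoc intro!: restrict_ext)
  next
    fix u assume "u \<in> carrier ?G"
    then obtain f q where u: "u = (f, q)" and h: "f \<in> \<Omega> \<rightarrow>\<^sub>E carrier D"
        "finite {x \<in> \<Omega>. f x \<noteq> \<one>\<^bsub>D\<^esub>}" "q \<in> carrier Q"
      by (auto simp: C)
    show "\<one>\<^bsub>?G\<^esub> \<otimes>\<^bsub>?G\<^esub> u = u"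
      using h one unfolding u one_restricted_wreath mult_restricted_wreath
      by (auto simp: PiE_iff extensional_def fun_eq_iff)
    let ?v = "(\<lambda>x\<in>\<Omega>. inv\<^bsub>D\<^esub> f (\<alpha> q x), inv\<^bsub>Q\<^esub> q)"
    have "{x \<in> \<Omega>. inv\<^bsub>D\<^esub> f (\<alpha> q x) \<noteq> \<one>\<^bsub>D\<^esub>} \<subseteq> {x \<in> \<Omega>. f (\<alpha> q x) \<noteq> \<one>\<^bsub>D\<^esub>}"
      by auto
    then have "finite {x \<in> \<Omega>. inv\<^bsub>D\<^esub> f (\<alpha> q x) \<noteq> \<one>\<^bsub>D\<^esub>}"
      using fin[OF h(3,2)] by (rule finite_subset)
    then have "?v \<in> carrier ?G"
      using h cl unfolding C by (auto simp: PiE_iff cong: conj_cong)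
    moreover have "?v \<otimes>\<^bsub>?G\<^esub> u = \<one>\<^bsub>?G\<^esub>"
      using h cl unfolding u one_restricted_wreath mult_restricted_wreath
      by (auto simp: PiE_iff intro!: restrict_ext)
    ultimately show "\<exists>v \<in> carrier ?G. v \<otimes>\<^bsub>?G\<^esub> u = \<one>\<^bsub>?G\<^esub>" by blast
  qed
qed

end

theory Submission
  imports Defs
begin

text \<open>Suppose that the conjugacy class of \<open>(a, q)\<close> is finite. Only finitely many points of
  \<open>\<Omega>\<close> lie in the support of the first component of some conjugate; this set of points is
  \<open>Q\<close>-invariant and, after conjugating by a function supported on one point, is seen to contain
  every \<open>x\<close> with \<open>a x \<noteq> 1\<close> or \<open>q x \<noteq> x\<close>. So such points have finite orbits. If \<open>D\<close> is icc, no
  such point exists at all: conjugating by functions supported at \<open>x\<close> changes the value at \<open>x\<close> to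
  any \<open>d a(x)\<close> (when \<open>q x \<noteq> x\<close>) or to any conjugate of \<open>a x\<close> (when \<open>q x = x\<close>). What remains are
  the elements \<open>(1, q)\<close> with \<open>q\<close> acting trivially, whose class is that of \<open>q\<close> in \<open>Q\<close>.
  Conversely, if \<open>x\<close> has a finite orbit and \<open>d \<noteq> 1\<close> has a finite class in \<open>D\<close>, the function with
  value \<open>d\<close> at \<open>x\<close> and \<open>1\<close> elsewhere has a finite class.\<close>

section \<open>Conjugacy classes in an arbitrary group\<close>

lemma (in group) conj_class_subset_carrier: "g \<in> carrier G \<Longrightarrow> conj_class G g \<subseteq> carrier G"
  by (auto simp: conj_class_def)

lemma (in group) conj_class_mono:
  assumes "g \<in> carrier G" "g' \<in> conj_class G g"
  shows "conj_class G g' \<subseteq> conj_class G g"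
proof
  fix u assume "u \<in> conj_class G g'"
  then obtain h where h: "h \<in> carrier G" "u = h \<otimes> g' \<otimes> inv h"
    by (auto simp: conj_class_def)
  obtain k where k: "k \<in> carrier G" "g' = k \<otimes> g \<otimes> inv k"
    using assms(2) by (auto simp: conj_class_def)
  have "u = (h \<otimes> k) \<otimes> g \<otimes> inv (h \<otimes> k)"
    unfolding h(2) k(2) using h(1) k(1) assms(1) by (simp add: inv_mult_group m_assoc)
  then show "u \<in> conj_class G g"
    using h(1) k(1) by (auto simp: conj_class_def)
qed

text \<open>Icc fails either through a nontrivial finite class or through a finite carrier. In the
  latter case every class is finite and any nontrivial element serves, hence the assumption of
  nontriviality.\<close>

lemma (in group) not_icc_obtains:
  assumes "carrier G \<noteq> {\<one>}" and "\<not> icc G"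
  obtains d where "d \<in> carrier G" "d \<noteq> \<one>" "finite (conj_class G d)"
proof (cases "finite (carrier G)")
  case True
  obtain d where d: "d \<in> carrier G" "d \<noteq> \<one>"
    using assms(1) one_closed by blast
  then have "finite (conj_class G d)"
    using finite_subset[OF conj_class_subset_carrier True] by simp
  with d show ?thesis by (rule that)
next
  case False
  then obtain d where "d \<in> carrier G" "d \<noteq> \<one>" "finite (conj_class G d)"
    using assms(2) by (auto simp: icc_def)
  then show ?thesis by (rule that)
qed

section \<open>The action and the functions of finite support\<close>

locale wreath = D: group D + Q: group Q + group_action Q \<Omega> \<alpha>
  for D :: "('d, 'm) monoid_scheme" and Q :: "('q, 'k) monoid_scheme"
    and \<Omega> :: "'x set" and \<alpha> :: "'q \<Rightarrow> 'x \<Rightarrow> 'x"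
begin

abbreviation W where "W \<equiv> restricted_wreath D Q \<Omega> \<alpha>"

definition base where
  "base = {f \<in> \<Omega> \<rightarrow>\<^sub>E carrier D. finite {x \<in> \<Omega>. f x \<noteq> \<one>\<^bsub>D\<^esub>}}"

text \<open>For \<open>x\<close> outside \<Omega> this is the identity function, so it lies in
  \<open>base\<close> whatever \<open>x\<close> is.\<close>

definition point_mass :: "'x \<Rightarrow> 'd \<Rightarrow> 'x \<Rightarrow> 'd" where
  "point_mass x d = (\<lambda>y\<in>\<Omega>. if y = x then d else \<one>\<^bsub>D\<^esub>)"

sublocale W: group W
  using group_restricted_wreath D.is_group group_action_axioms by blast

lemma carrier_W: "carrier W = base \<times> carrier Q"
  by (simp add: carrier_restricted_wreath base_def)

lemma act_closed [simp]: "q \<in> carrier Q \<Longrightarrow> x \<in> \<Omega> \<Longrightarrow> \<alpha> q x \<in> \<Omega>"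
  using element_image by blast

lemma act_one [simp]: "x \<in> \<Omega> \<Longrightarrow> \<alpha> \<one>\<^bsub>Q\<^esub> x = x"
  using id_eq_one by (metis restrict_apply')

lemma act_inv_act [simp]: "q \<in> carrier Q \<Longrightarrow> x \<in> \<Omega> \<Longrightarrow> \<alpha> (inv\<^bsub>Q\<^esub> q) (\<alpha> q x) = x"
  using orbit_sym_aux by blast

lemma act_act_inv [simp]: "q \<in> carrier Q \<Longrightarrow> x \<in> \<Omega> \<Longrightarrow> \<alpha> q (\<alpha> (inv\<^bsub>Q\<^esub> q) x) = x"
  using act_inv_act[of "inv\<^bsub>Q\<^esub> q" x] by simp

lemma act_mult:
  "q \<in> carrier Q \<Longrightarrow> q' \<in> carrier Q \<Longrightarrow> x \<in> \<Omega> \<Longrightarrow> \<alpha> (q \<otimes>\<^bsub>Q\<^esub> q') x = \<alpha> q (\<alpha> q' x)"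
  by (rule composition_rule)

lemma base_closed: "f \<in> base \<Longrightarrow> x \<in> \<Omega> \<Longrightarrow> f x \<in> carrier D"
  by (auto simp: base_def)

lemma base_extensional: "f \<in> base \<Longrightarrow> f \<in> extensional \<Omega>"
  by (simp add: base_def PiE_def)

lemma base_finite: "f \<in> base \<Longrightarrow> finite {x \<in> \<Omega>. f x \<noteq> \<one>\<^bsub>D\<^esub>}"
  by (simp add: base_def)

lemma one_base: "(\<lambda>x\<in>\<Omega>. \<one>\<^bsub>D\<^esub>) \<in> base"
  by (auto simp: base_def cong: conj_cong)

lemma point_mass_base: "d \<in> carrier D \<Longrightarrow> point_mass x d \<in> base"
  by (auto simp: base_def point_mass_def intro: finite_subset[of _ "{x}"])

section \<open>Inverses and conjugates in coordinates\<close>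

lemma inv_wreath:
  assumes "f \<in> base" "h \<in> carrier Q"
  shows "inv\<^bsub>W\<^esub> (f, h) = (\<lambda>x\<in>\<Omega>. inv\<^bsub>D\<^esub> f (\<alpha> h x), inv\<^bsub>Q\<^esub> h)"
proof -
  have u: "(f, h) \<in> carrier W"
    using assms by (simp add: carrier_W)
  obtain a b where ab: "inv\<^bsub>W\<^esub> (f, h) = (a, b)" by fastforce
  have "(a, b) \<in> carrier W" using W.inv_closed[OF u] ab by simp
  then have a: "a \<in> base" and b: "b \<in> carrier Q" by (auto simp: carrier_W)
  \<comment> \<open>Both components of the inverse are read off from the left inverse equation: the
    second gives \<open>b\<close>, and with it the first determines \<open>a\<close>
    pointwise.\<close>
  have eq: "(\<lambda>x\<in>\<Omega>. a x \<otimes>\<^bsub>D\<^esub> f (\<alpha> (inv\<^bsub>Q\<^esub> b) x), b \<otimes>\<^bsub>Q\<^esub> h) = (\<lambda>x\<in>\<Omega>. \<one>\<^bsub>D\<^esub>, \<one>\<^bsub>Q\<^esub>)"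
    using W.l_inv[OF u] unfolding ab mult_restricted_wreath one_restricted_wreath .
  then have bh: "b = inv\<^bsub>Q\<^esub> h"
    using b assms(2) Q.inv_equality by auto
  have "a x = inv\<^bsub>D\<^esub> f (\<alpha> h x)" if x: "x \<in> \<Omega>" for x
  proof -
    have "a x \<otimes>\<^bsub>D\<^esub> f (\<alpha> h x) = \<one>\<^bsub>D\<^esub>"
      using eq x bh assms(2) by (auto dest!: fun_cong[of _ _ x])
    then show ?thesis
      using D.inv_equality base_closed[OF a x] base_closed[OF assms(1) act_closed[OF assms(2) x]]
      by metis
  qed
  then have "a = (\<lambda>x\<in>\<Omega>. inv\<^bsub>D\<^esub> f (\<alpha> h x))"
    by (intro extensionalityI[OF base_extensional[OF a] restrict_extensional]) simp
  with ab bh show ?thesis by simp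
qed

text \<open>The last argument is \<open>y\<close> moved by h q^-1 h^-1, the inverse of the second
  component. It is kept as three successive actions, so that a trivial \<open>h\<close> or a
  trivially acting \<open>q\<close> simplifies in place.\<close>

lemma conj_wreath:
  assumes "f \<in> base" "h \<in> carrier Q" "a \<in> base" "q \<in> carrier Q"
  shows "(f, h) \<otimes>\<^bsub>W\<^esub> (a, q) \<otimes>\<^bsub>W\<^esub> inv\<^bsub>W\<^esub> (f, h) =
    (\<lambda>y\<in>\<Omega>. f y \<otimes>\<^bsub>D\<^esub> a (\<alpha> (inv\<^bsub>Q\<^esub> h) y) \<otimes>\<^bsub>D\<^esub> inv\<^bsub>D\<^esub> f (\<alpha> h (\<alpha> (inv\<^bsub>Q\<^esub> q) (\<alpha> (inv\<^bsub>Q\<^esub> h) y))),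
     h \<otimes>\<^bsub>Q\<^esub> q \<otimes>\<^bsub>Q\<^esub> inv\<^bsub>Q\<^esub> h)"
  unfolding inv_wreath[OF assms(1,2)] mult_restricted_wreath
  using assms(2,4) by (auto simp: Q.inv_mult_group act_mult intro!: restrict_ext)

lemma conj_class_wreath:
  assumes "a \<in> base" "q \<in> carrier Q"
  shows "conj_class W (a, q) =
    {(\<lambda>y\<in>\<Omega>. f y \<otimes>\<^bsub>D\<^esub> a (\<alpha> (inv\<^bsub>Q\<^esub> h) y) \<otimes>\<^bsub>D\<^esub> inv\<^bsub>D\<^esub> f (\<alpha> h (\<alpha> (inv\<^bsub>Q\<^esub> q) (\<alpha> (inv\<^bsub>Q\<^esub> h) y))),
      h \<otimes>\<^bsub>Q\<^esub> q \<otimes>\<^bsub>Q\<^esub> inv\<^bsub>Q\<^esub> h) | f h. f \<in> base \<and> h \<in> carrier Q}"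
    (is "_ = {?F f h | f h. _}")
proof -
  have "conj_class W (a, q) = (\<lambda>u. u \<otimes>\<^bsub>W\<^esub> (a, q) \<otimes>\<^bsub>W\<^esub> inv\<^bsub>W\<^esub> u) ` (base \<times> carrier Q)"
    unfolding conj_class_def carrier_W by blast
  also have "\<dots> = (\<lambda>(f, h). ?F f h) ` (base \<times> carrier Q)"
    by (rule image_cong[OF refl]) (clarify, rule conj_wreath[OF _ _ assms])
  also have "\<dots> = {?F f h | f h. f \<in> base \<and> h \<in> carrier Q}"
    by fast
  finally show ?thesis .
qed

text \<open>The second projection is a homomorphism onto \<open>Q\<close>, so it maps classes onto
  classes; pairing \<open>h\<close> with the trivial function lifts it.\<close>

lemma snd_conj_class:
  assumes "a \<in> base" "q \<in> carrier Q"
  shows "snd ` conj_class W (a, q) = conj_class Q q"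
  unfolding conj_class_wreath[OF assms] unfolding conj_class_def
  using one_base by (force simp: image_iff)

section \<open>Classes bounded by data of \<open>D\<close> and \<open>Q\<close>\<close>

lemma conj_class_act_trivial:
  assumes q: "q \<in> carrier Q" and triv: "\<And>x. x \<in> \<Omega> \<Longrightarrow> \<alpha> q x = x"
  shows "conj_class W (\<lambda>x\<in>\<Omega>. \<one>\<^bsub>D\<^esub>, q) \<subseteq> {\<lambda>x\<in>\<Omega>. \<one>\<^bsub>D\<^esub>} \<times> conj_class Q q"
proof -
  have inv_triv: "\<alpha> (inv\<^bsub>Q\<^esub> q) x = x" if "x \<in> \<Omega>" for x
    using act_inv_act[OF q that] triv[OF that] by simp
  \<comment> \<open>As \<open>q\<close> acts trivially, the last argument reduces to
    \<open>y\<close>, and \<open>f y\<close> cancels against its inverse.\<close>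
  have "(\<lambda>y\<in>\<Omega>. f y \<otimes>\<^bsub>D\<^esub> (\<lambda>x\<in>\<Omega>. \<one>\<^bsub>D\<^esub>) (\<alpha> (inv\<^bsub>Q\<^esub> h) y)
      \<otimes>\<^bsub>D\<^esub> inv\<^bsub>D\<^esub> f (\<alpha> h (\<alpha> (inv\<^bsub>Q\<^esub> q) (\<alpha> (inv\<^bsub>Q\<^esub> h) y)))) = (\<lambda>x\<in>\<Omega>. \<one>\<^bsub>D\<^esub>)"
    if "f \<in> base" "h \<in> carrier Q" for f h
    by (rule restrict_ext) (use that in \<open>simp add: inv_triv base_closed[OF that(1)]\<close>)
  then have "fst ` conj_class W (\<lambda>x\<in>\<Omega>. \<one>\<^bsub>D\<^esub>, q) \<subseteq> {\<lambda>x\<in>\<Omega>. \<one>\<^bsub>D\<^esub>}"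
    unfolding conj_class_wreath[OF one_base q] by auto
  then show ?thesis
    using snd_conj_class[OF one_base q] by (intro subrelI) force
qed

text \<open>With trivial second component, \<open>f\<close> and its inverse are evaluated at the
  same point. So \<open>h\<close> moves the support from \<open>x\<close> to
  \<open>\<alpha> h x\<close>, and \<open>f\<close> conjugates the value there.\<close>

lemma conj_class_point_mass:
  assumes x: "x \<in> \<Omega>" and d: "d \<in> carrier D"
  shows "conj_class W (point_mass x d, \<one>\<^bsub>Q\<^esub>) \<subseteq>
    (\<lambda>(y, c). (point_mass y c, \<one>\<^bsub>Q\<^esub>)) ` (orbit Q \<alpha> x \<times> conj_class D d)"
proof -
  have "(\<lambda>y\<in>\<Omega>. f y \<otimes>\<^bsub>D\<^esub> point_mass x d (\<alpha> (inv\<^bsub>Q\<^esub> h) y)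
      \<otimes>\<^bsub>D\<^esub> inv\<^bsub>D\<^esub> f (\<alpha> h (\<alpha> (inv\<^bsub>Q\<^esub> \<one>\<^bsub>Q\<^esub>) (\<alpha> (inv\<^bsub>Q\<^esub> h) y))))
    = point_mass (\<alpha> h x) (f (\<alpha> h x) \<otimes>\<^bsub>D\<^esub> d \<otimes>\<^bsub>D\<^esub> inv\<^bsub>D\<^esub> f (\<alpha> h x))"
    if f: "f \<in> base" and h: "h \<in> carrier Q" for f h
    unfolding point_mass_def
  proof (rule restrict_ext)
    fix y assume y: "y \<in> \<Omega>"
    have "\<alpha> (inv\<^bsub>Q\<^esub> h) y = x \<longleftrightarrow> y = \<alpha> h x"
      using x y h by auto
    then show "f y \<otimes>\<^bsub>D\<^esub> (\<lambda>y\<in>\<Omega>. if y = x then d else \<one>\<^bsub>D\<^esub>) (\<alpha> (inv\<^bsub>Q\<^esub> h) y)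
        \<otimes>\<^bsub>D\<^esub> inv\<^bsub>D\<^esub> f (\<alpha> h (\<alpha> (inv\<^bsub>Q\<^esub> \<one>\<^bsub>Q\<^esub>) (\<alpha> (inv\<^bsub>Q\<^esub> h) y)))
      = (if y = \<alpha> h x then f (\<alpha> h x) \<otimes>\<^bsub>D\<^esub> d \<otimes>\<^bsub>D\<^esub> inv\<^bsub>D\<^esub> f (\<alpha> h x) else \<one>\<^bsub>D\<^esub>)"
      using y h base_closed[OF f y] by simp
  qed
  note conjugate = this
  show ?thesis
  proof
    fix u assume "u \<in> conj_class W (point_mass x d, \<one>\<^bsub>Q\<^esub>)"
    then obtain f h where f: "f \<in> base" and h: "h \<in> carrier Q"
      and u: "u = (point_mass (\<alpha> h x) (f (\<alpha> h x) \<otimes>\<^bsub>D\<^esub> d \<otimes>\<^bsub>D\<^esub> inv\<^bsub>D\<^esub> f (\<alpha> h x)), \<one>\<^bsub>Q\<^esub>)"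
      unfolding conj_class_wreath[OF point_mass_base[OF d] Q.one_closed]
      by (auto simp: conjugate simp del: Q.inv_one)
    have "\<alpha> h x \<in> orbit Q \<alpha> x"
      using h by (auto simp: orbit_def)
    moreover have "f (\<alpha> h x) \<otimes>\<^bsub>D\<^esub> d \<otimes>\<^bsub>D\<^esub> inv\<^bsub>D\<^esub> f (\<alpha> h x) \<in> conj_class D d"
      using base_closed[OF f act_closed[OF h x]] by (auto simp: conj_class_def)
    ultimately show "u \<in> (\<lambda>(y, c). (point_mass y c, \<one>\<^bsub>Q\<^esub>)) ` (orbit Q \<alpha> x \<times> conj_class D d)"
      unfolding u by (intro image_eqI[OF _ SigmaI]) auto
  qed
qed

section \<open>Values and supports of conjugates\<close>

lemma conj_class_value_at:
  assumes ab: "a \<in> base" "q \<in> carrier Q" and x: "x \<in> \<Omega>" and d: "d \<in> carrier D"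
  shows "d \<otimes>\<^bsub>D\<^esub> a x \<otimes>\<^bsub>D\<^esub> (if \<alpha> q x = x then inv\<^bsub>D\<^esub> d else \<one>\<^bsub>D\<^esub>)
    \<in> (\<lambda>u. fst u x) ` conj_class W (a, q)"
proof -
  \<comment> \<open>The conjugator has value \<open>d\<close> at \<open>x\<close> and 1 elsewhere.
    Its inverse enters at q^-1 x, so it contributes \<open>inv d\<close> exactly when
    \<open>q\<close> fixes \<open>x\<close>.\<close>
  let ?f = "point_mass x d"
  let ?b = "\<lambda>y\<in>\<Omega>. ?f y \<otimes>\<^bsub>D\<^esub> a (\<alpha> (inv\<^bsub>Q\<^esub> \<one>\<^bsub>Q\<^esub>) y) \<otimes>\<^bsub>D\<^esub>
    inv\<^bsub>D\<^esub> ?f (\<alpha> \<one>\<^bsub>Q\<^esub> (\<alpha> (inv\<^bsub>Q\<^esub> q) (\<alpha> (inv\<^bsub>Q\<^esub> \<one>\<^bsub>Q\<^esub>) y)))"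
  have "\<alpha> (inv\<^bsub>Q\<^esub> q) x = x \<longleftrightarrow> \<alpha> q x = x"
    using act_inv_act act_act_inv ab(2) x by metis
  then have "d \<otimes>\<^bsub>D\<^esub> a x \<otimes>\<^bsub>D\<^esub> (if \<alpha> q x = x then inv\<^bsub>D\<^esub> d else \<one>\<^bsub>D\<^esub>) = ?b x"
    using ab(2) x d by (simp add: point_mass_def)
  moreover have "(?b, \<one>\<^bsub>Q\<^esub> \<otimes>\<^bsub>Q\<^esub> q \<otimes>\<^bsub>Q\<^esub> inv\<^bsub>Q\<^esub> \<one>\<^bsub>Q\<^esub>) \<in> conj_class W (a, q)"
    unfolding conj_class_wreath[OF ab] using point_mass_base[OF d] Q.one_closed by blast
  ultimately show ?thesis
    by (intro image_eqI) auto
qed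

text \<open>Conjugating by \<open>h\<close> with the trivial function merely translates. This makes
  the union of the supports over a class invariant under \<open>Q\<close>.\<close>

lemma conj_class_translate:
  assumes ab: "a \<in> base" "q \<in> carrier Q" and x: "x \<in> \<Omega>" and h: "h \<in> carrier Q"
  obtains b r where "(b, r) \<in> conj_class W (a, q)" "b (\<alpha> h x) = a x"
proof
  let ?e = "\<lambda>x\<in>\<Omega>. \<one>\<^bsub>D\<^esub>"
  let ?b = "\<lambda>y\<in>\<Omega>. ?e y \<otimes>\<^bsub>D\<^esub> a (\<alpha> (inv\<^bsub>Q\<^esub> h) y)
    \<otimes>\<^bsub>D\<^esub> inv\<^bsub>D\<^esub> ?e (\<alpha> h (\<alpha> (inv\<^bsub>Q\<^esub> q) (\<alpha> (inv\<^bsub>Q\<^esub> h) y)))"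
  show "(?b, h \<otimes>\<^bsub>Q\<^esub> q \<otimes>\<^bsub>Q\<^esub> inv\<^bsub>Q\<^esub> h) \<in> conj_class W (a, q)"
    unfolding conj_class_wreath[OF ab] using one_base h by blast
  show "?b (\<alpha> h x) = a x"
    using base_closed[OF ab(1) x] ab x h by simp
qed

lemma finite_orbit_if_finite_conj_class:
  assumes D: "carrier D \<noteq> {\<one>\<^bsub>D\<^esub>}" and ab: "a \<in> base" "q \<in> carrier Q" and x: "x \<in> \<Omega>"
    and moved: "a x \<noteq> \<one>\<^bsub>D\<^esub> \<or> \<alpha> q x \<noteq> x" and fin: "finite (conj_class W (a, q))"
  shows "finite (orbit Q \<alpha> x)"
proof -
  have ab_carrier: "(a, q) \<in> carrier W" using ab by (simp add: carrier_W)
  \<comment> \<open>If \<open>a x\<close> is trivial, then \<open>q\<close> moves \<open>x\<close>,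
    and a nontrivial \<open>d\<close> placed at \<open>x\<close> becomes the value of a conjugate
    there. Otherwise translation by the identity already gives the value \<open>a x\<close>.\<close>
  have "\<exists>(b, r) \<in> conj_class W (a, q). b x \<noteq> \<one>\<^bsub>D\<^esub>"
  proof (cases "a x = \<one>\<^bsub>D\<^esub>")
    case True
    obtain d where d: "d \<in> carrier D" "d \<noteq> \<one>\<^bsub>D\<^esub>"
      using D D.one_closed by blast
    show ?thesis
      using conj_class_value_at[OF ab x d(1)] d moved True by auto
  next
    case False
    obtain b r where "(b, r) \<in> conj_class W (a, q)" "b (\<alpha> \<one>\<^bsub>Q\<^esub> x) = a x"
      by (rule conj_class_translate[OF ab x Q.one_closed])
    with False x show ?thesis by (intro bexI[of _ "(b, r)"]) auto
  qed
  then obtain b r where br: "(b, r) \<in> conj_class W (a, q)" "b x \<noteq> \<one>\<^bsub>D\<^esub>" by blast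
  then have b: "b \<in> base" and r: "r \<in> carrier Q"
    using W.conj_class_subset_carrier[OF ab_carrier] by (auto simp: carrier_W)
  have same: "conj_class W (b, r) \<subseteq> conj_class W (a, q)"
    by (rule W.conj_class_mono[OF ab_carrier br(1)])
  \<comment> \<open>Translates of \<open>(b, r)\<close> stay in the class of \<open>(a, q)\<close>
    and carry the nontrivial value \<open>b x\<close> along the orbit. The right side is a finite
    union of finite supports.\<close>
  have "orbit Q \<alpha> x \<subseteq> (\<Union>u \<in> conj_class W (a, q). {y \<in> \<Omega>. fst u y \<noteq> \<one>\<^bsub>D\<^esub>})"
  proof
    fix y assume "y \<in> orbit Q \<alpha> x"
    then obtain h where h: "h \<in> carrier Q" "y = \<alpha> h x" by (auto simp: orbit_def)
    obtain c s where "(c, s) \<in> conj_class W (b, r)" "c y = b x"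
      using h(2) by (auto elim: conj_class_translate[OF b r x h(1)])
    then show "y \<in> (\<Union>u \<in> conj_class W (a, q). {y \<in> \<Omega>. fst u y \<noteq> \<one>\<^bsub>D\<^esub>})"
      using same br(2) h x by force
  qed
  moreover have "finite {y \<in> \<Omega>. fst u y \<noteq> \<one>\<^bsub>D\<^esub>}" if "u \<in> conj_class W (a, q)" for u
    using that W.conj_class_subset_carrier[OF ab_carrier] base_finite by (auto simp: carrier_W)
  ultimately show ?thesis
    using fin finite_subset by blast
qed

text \<open>It suffices that the conjugates take infinitely many values at \<open>x\<close>.\<close>

lemma infinite_conj_class_if_icc:
  assumes D: "icc D" and ab: "a \<in> base" "q \<in> carrier Q" and x: "x \<in> \<Omega>"
    and moved: "a x \<noteq> \<one>\<^bsub>D\<^esub> \<or> \<alpha> q x \<noteq> x"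
  shows "infinite (conj_class W (a, q))"
proof -
  have ax: "a x \<in> carrier D" using base_closed[OF ab(1) x] .
  let ?V = "(\<lambda>d. d \<otimes>\<^bsub>D\<^esub> a x \<otimes>\<^bsub>D\<^esub> (if \<alpha> q x = x then inv\<^bsub>D\<^esub> d else \<one>\<^bsub>D\<^esub>)) ` carrier D"
  have "infinite ?V"
  proof (cases "\<alpha> q x = x")
    case True
    \<comment> \<open>Since \<open>q\<close> fixes \<open>x\<close>, \<open>moved\<close> makes
      \<open>a x\<close> nontrivial, so its class is infinite.\<close>
    then have "?V = conj_class D (a x)" by (auto simp: conj_class_def)
    then show ?thesis using D moved True ax by (simp add: icc_def)
  next
    case False
    \<comment> \<open>Right multiplication by \<open>a x\<close> is injective, and an icc group has
      an infinite carrier.\<close>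
    have "inj_on (\<lambda>d. d \<otimes>\<^bsub>D\<^esub> a x \<otimes>\<^bsub>D\<^esub> (if \<alpha> q x = x then inv\<^bsub>D\<^esub> d else \<one>\<^bsub>D\<^esub>)) (carrier D)"
      using ax False by (auto intro!: inj_onI)
    then show ?thesis
      using D finite_imageD unfolding icc_def by blast
  qed
  moreover have "?V \<subseteq> (\<lambda>u. fst u x) ` conj_class W (a, q)"
    using conj_class_value_at[OF ab x] by blast
  ultimately show ?thesis
    using finite_subset finite_imageI by blast
qed

section \<open>Assembling the equivalence\<close>

lemma icc_wreath_iff:
  assumes D: "carrier D \<noteq> {\<one>\<^bsub>D\<^esub>}" and W: "carrier W \<noteq> {\<one>\<^bsub>W\<^esub>}"
  shows "icc W \<longleftrightarrow> (icc D \<or> (\<forall>X \<in> orbits Q \<Omega> \<alpha>. infinite X)) \<and>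
    {q \<in> FC Q. \<forall>x \<in> \<Omega>. \<alpha> q x = x} = {\<one>\<^bsub>Q\<^esub>}" (is "_ \<longleftrightarrow> ?one \<and> ?two")
proof
  assume icc: "icc W"
  have ?one
  proof (rule ccontr)
    assume "\<not> ?one"
    then obtain x where nicc: "\<not> icc D" and x: "x \<in> \<Omega>" "finite (orbit Q \<alpha> x)"
      by (auto simp: orbits_def)
    obtain d where d: "d \<in> carrier D" "d \<noteq> \<one>\<^bsub>D\<^esub>" "finite (conj_class D d)"
      using D.not_icc_obtains[OF D nicc] by blast
    have "finite (conj_class W (point_mass x d, \<one>\<^bsub>Q\<^esub>))"
      by (rule finite_subset[OF conj_class_point_mass[OF x(1) d(1)]]) (use x d in simp)
    moreover have "(point_mass x d, \<one>\<^bsub>Q\<^esub>) \<in> carrier W"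
      using point_mass_base[OF d(1)] by (simp add: carrier_W)
    moreover have "(point_mass x d, \<one>\<^bsub>Q\<^esub>) \<noteq> \<one>\<^bsub>W\<^esub>"
      using x d by (auto simp: one_restricted_wreath point_mass_def dest!: fun_cong[of _ _ x])
    ultimately show False using icc unfolding icc_def by blast
  qed
  moreover have ?two
  proof -
    have "q = \<one>\<^bsub>Q\<^esub>" if q: "q \<in> FC Q" and triv: "\<And>x. x \<in> \<Omega> \<Longrightarrow> \<alpha> q x = x" for q
    proof -
      have qc: "q \<in> carrier Q" and "finite (conj_class Q q)" using q by (auto simp: FC_def)
      then have "finite (conj_class W (\<lambda>x\<in>\<Omega>. \<one>\<^bsub>D\<^esub>, q))"
        using finite_subset[OF conj_class_act_trivial[OF qc triv]] by simp
      moreover have "(\<lambda>x\<in>\<Omega>. \<one>\<^bsub>D\<^esub>, q) \<in> carrier W"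
        using one_base qc by (simp add: carrier_W)
      ultimately show ?thesis
        using icc unfolding icc_def one_restricted_wreath by blast
    qed
    \<comment> \<open>Equality with a singleton also requires that 1 itself belong to
      \<open>FC Q\<close>.\<close>
    moreover have "conj_class Q \<one>\<^bsub>Q\<^esub> \<subseteq> {\<one>\<^bsub>Q\<^esub>}" by (auto simp: conj_class_def)
    then have "\<one>\<^bsub>Q\<^esub> \<in> FC Q"
      by (auto simp: FC_def intro: finite_subset)
    ultimately show ?thesis using act_one by blast
  qed
  ultimately show "?one \<and> ?two" ..
next
  assume R: "?one \<and> ?two"
  have inf: "infinite (conj_class W u)" if u: "u \<in> carrier W" "u \<noteq> \<one>\<^bsub>W\<^esub>" for u
  proof -
    obtain a q where aq: "u = (a, q)" "a \<in> base" "q \<in> carrier Q"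
      using u(1) by (auto simp: carrier_W)
    show ?thesis
    proof (cases "\<exists>x \<in> \<Omega>. a x \<noteq> \<one>\<^bsub>D\<^esub> \<or> \<alpha> q x \<noteq> x")
      case True
      then obtain x where x: "x \<in> \<Omega>" "a x \<noteq> \<one>\<^bsub>D\<^esub> \<or> \<alpha> q x \<noteq> x" by blast
      show ?thesis
      proof (cases "icc D")
        case True
        then show ?thesis using infinite_conj_class_if_icc[OF _ aq(2,3) x] aq(1) by simp
      next
        case False
        then have "infinite (orbit Q \<alpha> x)" using R x(1) by (auto simp: orbits_def)
        then show ?thesis
          using finite_orbit_if_finite_conj_class[OF D aq(2,3) x] aq(1) by blast
      qed
    next
      case False
      \<comment> \<open>Here \<open>a\<close> is trivial and \<open>q\<close> fixes every point, so
        \<open>q\<close> must be nontrivial and condition (ii) puts it outside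
        \<open>FC Q\<close>.\<close>
      then have "a = (\<lambda>x\<in>\<Omega>. \<one>\<^bsub>D\<^esub>)"
        by (intro extensionalityI[OF base_extensional[OF aq(2)] restrict_extensional]) auto
      then have "q \<noteq> \<one>\<^bsub>Q\<^esub>" using u(2) aq(1) by (simp add: one_restricted_wreath)
      then have "infinite (conj_class Q q)" using R False aq(3) by (auto simp: FC_def)
      then show ?thesis
        using snd_conj_class[OF aq(2,3)] finite_imageI aq(1) by metis
    qed
  qed
  \<comment> \<open>Icc also demands an infinite carrier; the class of any nontrivial element
    provides it.\<close>
  obtain u where u: "u \<in> carrier W" "u \<noteq> \<one>\<^bsub>W\<^esub>"
    using W W.one_closed by blast
  then have "infinite (carrier W)"
    using inf W.conj_class_subset_carrier finite_subset by blast
  with inf show "icc W" unfolding icc_def by blast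
qed

end

theorem theorem4p1:
  fixes D :: "('d, 'm) monoid_scheme" and Q :: "('q, 'k) monoid_scheme"
    and \<Omega> :: "'x set" and \<alpha> :: "'q \<Rightarrow> 'x \<Rightarrow> 'x"
  assumes "group D" and "carrier D \<noteq> {\<one>\<^bsub>D\<^esub>}"
    and "group Q"
    and "group_action Q \<Omega> \<alpha>"
    and "carrier (restricted_wreath D Q \<Omega> \<alpha>) \<noteq> {\<one>\<^bsub>restricted_wreath D Q \<Omega> \<alpha>\<^esub>}"
  shows "icc (restricted_wreath D Q \<Omega> \<alpha>) \<longleftrightarrow>
    (icc D \<or> (\<forall>X \<in> orbits Q \<Omega> \<alpha>. infinite X)) \<and>
    {q \<in> FC Q. \<forall>x \<in> \<Omega>. \<alpha> q x = x} = {\<one>\<^bsub>Q\<^esub>}"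
proof -
  interpret wreath D Q \<Omega> \<alpha>
    using assms(1,3,4) by (rule wreath.intro)
  show ?thesis using assms(2,5) by (rule icc_wreath_iff)
qed

end
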